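(* Let $n_1,n_2$ be positive integers, $n=n_1n_2$, $1\le m\le n$, and let $A,B\in\mathbb{R}^{n\times n}$ be the matrices of the energy minimization problem for $m$ particles on the $n_1\times n_2$ toric grid (see context). Then $$PB(A,B)=QPB(A,B),$$ where $PB$ is the projected eigenvalue bound and $QPB$ the convex quadratic programming bound (see context).
   Context: $[k]=\{1,\dots,k\}$; $e$ is the all-ones vector; $I_k,J_k$ are the $k\times k$ identity and all-ones matrices; $\otimes$ is the Kronecker product; $\mathrm{vec}$ stacks columns; $\succcurlyeq0$ means symmetric positive semidefinite; $S_k$ is the set of permutations of $[k]$. The grid points $[n_1]\times[n_2]$ are identified with $[n]$ by any fixed ordering. The Lee distance is $d_{\mathrm{Lee}}((x_1,y_1),(x_2,y_2))=\min(|x_1-x_2|,n_1-|x_1-x_2|)+\min(|y_1-y_2|,n_2-|y_1-y_2|)$. The matrix $B=(b_{ij})$ has $b_{ij}=1/d_{\mathrm{Lee}}(i,j)$ for $i\ne j$ and $b_{ii}=0$. The matrix $A=(a_{ij})$ has $a_{ij}=1$ if $i,j\le m$ and $a_{ij}=0$ otherwise. Let $V$ be an $n\times(n-1)$ matrix whose columns form an orthonormal basis of the orthogonal complement of $e$; $\tilde A=V^TAV$, $\tilde B=V^TBV$, with eigenvalue vectors $\lambda_{\tilde A},\mu_{\tilde B}$. For vectors $x,y$ of length $k$, $\langle x,y\rangle^-=\min_{\varphi\in S_k}\sum_{i=1}^kx_{\varphi(i)}y_i$. With $D=(d_{ij})=\frac2nAJ_nB$, $$PB(A,B)=\langle\lambda_{\tilde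 A},\mu_{\tilde B}\rangle^-+\min_{\varphi\in S_n}\sum_{i=1}^nd_{i\varphi(i)}-\frac{(e^TAe)(e^TBe)}{n^2}.$$ Let $(S^*,T^* )$ be any optimal solution of $\max\{\mathrm{tr}(S+T): \tilde B\otimes\tilde A-I_{n-1}\otimes S-T\otimes I_{n-1}\succcurlyeq 0\}$ over symmetric $(n-1)\times(n-1)$ matrices $S,T$ (it is known that $\mathrm{tr}(S^*+T^* )=\langle\lambda_{\tilde A},\mu_{\tilde B}\rangle^-$), and put $\hat Q=\tilde B\otimes\tilde A-I_{n-1}\otimes S^*-T^*\otimes I_{n-1}\succcurlyeq0$. Then $$QPB(A,B)=\min\; y^T\hat Qy+\langle\lambda_{\tilde A},\mu_{\tilde B}\rangle^-+\frac2n\mathrm{tr}(BJ_nAX)-\frac{(e^TAe)(e^TBe)}{n^2},$$ the minimum being over all (entrywise nonnegative) doubly stochastic $X$, with $Y$ determined by $X=\frac1nee^T+VYV^T$ and $y=\mathrm{vec}(Y)$. *)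

theory Defs
  imports
    "Jordan_Normal_Form.Char_Poly"
    "Jordan_Normal_Form.VS_Connect"
    "HOL-Combinatorics.Permutations"
begin

text \<open>Matrix and vector indices start at 0, so \<open>[n]\<close> becomes \<open>{..<n}\<close> throughout;
  grid coordinates keep the range \<open>{1..n1} \<times> {1..n2}\<close>.\<close>

definition ones_vec :: "nat \<Rightarrow> real vec" where
  "ones_vec n = vec n (\<lambda>_. 1)"

definition ones_mat :: "nat \<Rightarrow> real mat" where
  "ones_mat n = mat n n (\<lambda>_. 1)"

definition mtrace :: "real mat \<Rightarrow> real" where
  "mtrace M = (\<Sum>i<dim_row M. M $$ (i, i))"

definition kron :: "real mat \<Rightarrow> real mat \<Rightarrow> real mat" where
  "kron M N = mat (dim_row M * dim_row N) (dim_col M * dim_col N)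
     (\<lambda>(i, j). M $$ (i div dim_row N, j div dim_col N) * N $$ (i mod dim_row N, j mod dim_col N))"

text \<open>Column stacking, so that \<open>kron N M *\<^sub>v vectorize Y = vectorize (M * Y * N\<^sup>T)\<close>.\<close>

definition vectorize :: "real mat \<Rightarrow> real vec" where
  "vectorize Y = vec (dim_row Y * dim_col Y) (\<lambda>k. Y $$ (k mod dim_row Y, k div dim_row Y))"

definition sym_mat :: "nat \<Rightarrow> real mat \<Rightarrow> bool" where
  "sym_mat k M \<longleftrightarrow> M \<in> carrier_mat k k \<and> M\<^sup>T = M"

definition psd :: "nat \<Rightarrow> real mat \<Rightarrow> bool" where
  "psd k M \<longleftrightarrow> sym_mat k M \<and> (\<forall>x\<in>carrier_vec k. x \<bullet> (M *\<^sub>v x) \<ge> 0)"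

definition doubly_stochastic :: "nat \<Rightarrow> real mat \<Rightarrow> bool" where
  "doubly_stochastic n X \<longleftrightarrow> X \<in> carrier_mat n n \<and>
     (\<forall>i<n. \<forall>j<n. X $$ (i, j) \<ge> 0) \<and>
     (\<forall>i<n. (\<Sum>j<n. X $$ (i, j)) = 1) \<and>
     (\<forall>j<n. (\<Sum>i<n. X $$ (i, j)) = 1)"

text \<open>The eigenvalues listed with algebraic multiplicity (in increasing order). Only used for
  real symmetric matrices, whose characteristic polynomial splits over the reals, so that the
  vector then has dimension \<open>dim_row M\<close>.\<close>

definition eigenvalue_vec :: "real mat \<Rightarrow> real vec" where
  "eigenvalue_vec M = vec_of_list (sorted_list_of_multiset (proots (char_poly M)))"

definition min_scalar_prod :: "real vec \<Rightarrow> real vec \<Rightarrow> real" where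
  "min_scalar_prod x y =
     Min ((\<lambda>\<phi>. \<Sum>i<dim_vec y. x $ \<phi> i * y $ i) ` {\<phi>. \<phi> permutes {..<dim_vec y}})"

definition lee_dist :: "nat \<Rightarrow> nat \<Rightarrow> nat \<times> nat \<Rightarrow> nat \<times> nat \<Rightarrow> int" where
  "lee_dist n1 n2 p q =
     (let dx = \<bar>int (fst p) - int (fst q)\<bar>; dy = \<bar>int (snd p) - int (snd q)\<bar>
      in min dx (int n1 - dx) + min dy (int n2 - dy))"

text \<open>\<open>g\<close> is the chosen ordering of the grid points: \<open>g i\<close> is the point with index \<open>i\<close>.\<close>

definition energy_B :: "nat \<Rightarrow> nat \<Rightarrow> (nat \<Rightarrow> nat \<times> nat) \<Rightarrow> real mat" where
  "energy_B n1 n2 g = mat (n1 * n2) (n1 * n2)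
     (\<lambda>(i, j). if i = j then 0 else 1 / real_of_int (lee_dist n1 n2 (g i) (g j)))"

definition energy_A :: "nat \<Rightarrow> nat \<Rightarrow> real mat" where
  "energy_A n m = mat n n (\<lambda>(i, j). if i < m \<and> j < m then 1 else 0)"

definition onb_ones_perp :: "nat \<Rightarrow> real mat \<Rightarrow> bool" where
  "onb_ones_perp n V \<longleftrightarrow> V \<in> carrier_mat n (n - 1) \<and>
     (\<forall>i<n - 1. \<forall>j<n - 1. col V i \<bullet> col V j = (if i = j then 1 else 0)) \<and>
     vec_space.col_space n V = vec_module.orthogonal_complement n {ones_vec n}"

definition proj :: "real mat \<Rightarrow> real mat \<Rightarrow> real mat" where
  "proj V M = V\<^sup>T * M * V"

definition PB :: "real mat \<Rightarrow> real mat \<Rightarrow> real mat \<Rightarrow> real" where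
  "PB V A B =
     (let n = dim_row A; e = ones_vec n;
          D = (2 / real n) \<cdot>\<^sub>m (A * ones_mat n * B)
      in min_scalar_prod (eigenvalue_vec (proj V A)) (eigenvalue_vec (proj V B))
         + Min ((\<lambda>\<phi>. \<Sum>i<n. D $$ (i, \<phi> i)) ` {\<phi>. \<phi> permutes {..<n}})
         - (e \<bullet> (A *\<^sub>v e)) * (e \<bullet> (B *\<^sub>v e)) / (real n)\<^sup>2)"

text \<open>The matrix \<open>kron B' A' - kron I S - kron T I\<close> of the semidefinite program, where
  \<open>A'\<close> and \<open>B'\<close> are the projections of \<open>A\<close> and \<open>B\<close>.\<close>

definition Q_slack :: "real mat \<Rightarrow> real mat \<Rightarrow> real mat \<Rightarrow> real mat \<Rightarrow> real mat \<Rightarrow> real mat" where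
  "Q_slack V A B S T =
     (let k = dim_col V
      in kron (proj V B) (proj V A) - kron (1\<^sub>m k) S - kron T (1\<^sub>m k))"

definition ST_feasible :: "real mat \<Rightarrow> real mat \<Rightarrow> real mat \<Rightarrow> real mat \<Rightarrow> real mat \<Rightarrow> bool" where
  "ST_feasible V A B S T \<longleftrightarrow> sym_mat (dim_col V) S \<and> sym_mat (dim_col V) T \<and>
     psd (dim_col V * dim_col V) (Q_slack V A B S T)"

definition ST_optimal :: "real mat \<Rightarrow> real mat \<Rightarrow> real mat \<Rightarrow> real mat \<Rightarrow> real mat \<Rightarrow> bool" where
  "ST_optimal V A B S T \<longleftrightarrow> ST_feasible V A B S T \<and>
     (\<forall>S' T'. ST_feasible V A B S' T' \<longrightarrow> mtrace (S' + T') \<le> mtrace (S + T))"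

definition QPB_objective ::
    "real mat \<Rightarrow> real mat \<Rightarrow> real mat \<Rightarrow> real mat \<Rightarrow> real mat \<Rightarrow> real mat \<Rightarrow> real mat \<Rightarrow> real" where
  "QPB_objective V A B S T X Y =
     (let n = dim_row A; e = ones_vec n; y = vectorize Y
      in y \<bullet> (Q_slack V A B S T *\<^sub>v y)
         + min_scalar_prod (eigenvalue_vec (proj V A)) (eigenvalue_vec (proj V B))
         + 2 / real n * mtrace (B * ones_mat n * A * X)
         - (e \<bullet> (A *\<^sub>v e)) * (e \<bullet> (B *\<^sub>v e)) / (real n)\<^sup>2)"

text \<open>For each doubly stochastic \<open>X\<close> there is exactly one admissible \<open>Y\<close>, namely \<open>V\<^sup>T * X * V\<close>.\<close>

definition QPB_values :: "real mat \<Rightarrow> real mat \<Rightarrow> real mat \<Rightarrow> real mat \<Rightarrow> real mat \<Rightarrow> real set" where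
  "QPB_values V A B S T =
     {QPB_objective V A B S T X Y | X Y.
        doubly_stochastic (dim_row A) X \<and> Y \<in> carrier_mat (dim_col V) (dim_col V) \<and>
        X = (1 / real (dim_row A)) \<cdot>\<^sub>m ones_mat (dim_row A) + V * Y * V\<^sup>T}"

text \<open>The least element of a set of reals; it is meaningful only if the minimum is attained.\<close>

definition QPB :: "real mat \<Rightarrow> real mat \<Rightarrow> real mat \<Rightarrow> real mat \<Rightarrow> real mat \<Rightarrow> real" where
  "QPB V A B S T = (LEAST q. q \<in> QPB_values V A B S T)"

end

theory Submission
  imports Defs
begin

text \<open>The torus is translation invariant, so all row and column sums of \<open>B\<close> have a common value
  \<open>b\<close>. Hence every permutation gives the same value of the linear assignment term of \<open>PB\<close>, every
  doubly stochastic \<open>X\<close> gives the same linear term of \<open>QPB\<close>, and the two values agree. The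
  quadratic term is nonnegative because the slack matrix is positive semidefinite, and it vanishes
  at \<open>Y = 0\<close>, which corresponds to the doubly stochastic matrix \<open>X = J / n\<close>.\<close>

lemma mult_ones_mat:
  assumes "M \<in> carrier_mat n n"
  shows "M * ones_mat n = mat n n (\<lambda>(i, j). \<Sum>k<n. M $$ (i, k))"
  using assms by (intro eq_matI) (auto simp: ones_mat_def scalar_prod_def atLeast0LessThan)

text \<open>Entry (i, j) of \<open>A * J * B\<close> is the i-th row sum of \<open>A\<close> times
  the j-th column sum of \<open>B\<close>. With constant column sums it depends on i alone, so the
  column chosen by \<open>\<phi>\<close> does not matter.\<close>

lemma assignment_term_const_col_sum:
  assumes A: "A \<in> carrier_mat n n" and B: "B \<in> carrier_mat n n"
    and cols: "\<And>j. j < n \<Longrightarrow> (\<Sum>i<n. B $$ (i, j)) = b"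
    and \<phi>: "\<phi> permutes {..<n}"
  shows "(\<Sum>i<n. (c \<cdot>\<^sub>m (A * ones_mat n * B)) $$ (i, \<phi> i)) = c * b * (\<Sum>i<n. \<Sum>j<n. A $$ (i, j))"
proof -
  have "(c \<cdot>\<^sub>m (A * ones_mat n * B)) $$ (i, \<phi> i) = c * b * (\<Sum>j<n. A $$ (i, j))" if "i < n" for i
  proof -
    have j: "\<phi> i < n"
      using permutes_in_image[OF \<phi>] that by simp
    have "(A * ones_mat n * B) $$ (i, \<phi> i) = (\<Sum>k<n. (\<Sum>j<n. A $$ (i, j)) * B $$ (k, \<phi> i))"
      using A B that j by (simp add: mult_ones_mat scalar_prod_def atLeast0LessThan)
    also have "\<dots> = b * (\<Sum>j<n. A $$ (i, j))"
      using cols[OF j] by (simp flip: sum_distrib_left)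
    finally show ?thesis
      using A B that j by simp
  qed
  then show ?thesis
    by (simp add: sum_distrib_left)
qed

text \<open>Constant row sums give \<open>B * J = b * J\<close>, so the trace is b times the sum of
  all entries of \<open>A * X\<close>; since the rows of \<open>X\<close> sum to 1, this is b times
  the sum of the entries of \<open>A\<close>.\<close>

lemma mtrace_const_row_sum:
  assumes A: "A \<in> carrier_mat n n" and B: "B \<in> carrier_mat n n"
    and rows: "\<And>i. i < n \<Longrightarrow> (\<Sum>j<n. B $$ (i, j)) = b"
    and X: "doubly_stochastic n X"
  shows "mtrace (B * ones_mat n * A * X) = b * (\<Sum>i<n. \<Sum>j<n. A $$ (i, j))"
proof -
  have Xc: "X \<in> carrier_mat n n" and Xrows: "\<And>i. i < n \<Longrightarrow> (\<Sum>j<n. X $$ (i, j)) = 1"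
    using X by (auto simp: doubly_stochastic_def)
  have "B * ones_mat n = mat n n (\<lambda>_. b)"
    using rows by (subst mult_ones_mat[OF B]) (auto intro!: eq_matI)
  then have "mtrace (B * ones_mat n * A * X)
      = (\<Sum>i<n. \<Sum>k<n. (\<Sum>l<n. b * A $$ (l, k)) * X $$ (k, i))"
    using A Xc by (simp add: mtrace_def scalar_prod_def atLeast0LessThan)
  also have "\<dots> = (\<Sum>k<n. (\<Sum>l<n. b * A $$ (l, k)) * (\<Sum>i<n. X $$ (k, i)))"
    \<comment> \<open>Summing over the column index of \<open>X\<close> first isolates its row
      sums.\<close>
    by (subst sum.swap) (simp add: sum_distrib_left)
  also have "\<dots> = (\<Sum>k<n. \<Sum>l<n. b * A $$ (l, k))"
    by (simp add: Xrows)
  also have "\<dots> = b * (\<Sum>i<n. \<Sum>j<n. A $$ (i, j))"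
    by (subst sum.swap) (simp add: sum_distrib_left)
  finally show ?thesis .
qed

lemma PB_const_col_sum:
  assumes A: "A \<in> carrier_mat n n" and B: "B \<in> carrier_mat n n"
    and cols: "\<And>j. j < n \<Longrightarrow> (\<Sum>i<n. B $$ (i, j)) = b"
  shows "PB V A B = min_scalar_prod (eigenvalue_vec (proj V A)) (eigenvalue_vec (proj V B))
    + 2 / real n * b * (\<Sum>i<n. \<Sum>j<n. A $$ (i, j))
    - (ones_vec n \<bullet> (A *\<^sub>v ones_vec n)) * (ones_vec n \<bullet> (B *\<^sub>v ones_vec n)) / (real n)\<^sup>2"
proof -
  let ?D = "(2 / real n) \<cdot>\<^sub>m (A * ones_mat n * B)"
  let ?P = "{\<phi>. \<phi> permutes {..<n}}"
  \<comment> \<open>Without a permutation the image would be empty instead of a singleton, and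
    \<open>Min\<close> would say nothing.\<close>
  have "?P \<noteq> {}"
    using permutes_id by blast
  moreover have "(\<lambda>\<phi>. \<Sum>i<n. ?D $$ (i, \<phi> i)) ` ?P
      = (\<lambda>_. 2 / real n * b * (\<Sum>i<n. \<Sum>j<n. A $$ (i, j))) ` ?P"
    using assignment_term_const_col_sum[OF A B cols] by (intro image_cong) blast+
  ultimately have "(\<lambda>\<phi>. \<Sum>i<n. ?D $$ (i, \<phi> i)) ` ?P
      = {2 / real n * b * (\<Sum>i<n. \<Sum>j<n. A $$ (i, j))}"
    by (simp add: image_constant_conv)
  then show ?thesis
    using A by (simp add: PB_def Let_def)
qed

text \<open>The linear terms of both bounds equal 2/n times b times the sum of the entries of
  \<open>A\<close>, so only the quadratic form separates the objective from
  \<open>PB\<close>.\<close>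

lemma QPB_objective_const_row_sum:
  assumes A: "A \<in> carrier_mat n n" and B: "B \<in> carrier_mat n n"
    and rows: "\<And>i. i < n \<Longrightarrow> (\<Sum>j<n. B $$ (i, j)) = b"
    and cols: "\<And>j. j < n \<Longrightarrow> (\<Sum>i<n. B $$ (i, j)) = b"
    and X: "doubly_stochastic n X"
  shows "QPB_objective V A B S T X Y
    = vectorize Y \<bullet> (Q_slack V A B S T *\<^sub>v vectorize Y) + PB V A B"
  using A by (simp add: QPB_objective_def Let_def mtrace_const_row_sum[OF A B rows X]
    PB_const_col_sum[OF A B cols])

lemma doubly_stochastic_uniform:
  assumes "n > 0"
  shows "doubly_stochastic n ((1 / real n) \<cdot>\<^sub>m ones_mat n)"
  using assms by (simp add: doubly_stochastic_def ones_mat_def)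

lemma PB_least_QPB_value:
  assumes n: "n > 0" and A: "A \<in> carrier_mat n n" and B: "B \<in> carrier_mat n n"
    and rows: "\<And>i. i < n \<Longrightarrow> (\<Sum>j<n. B $$ (i, j)) = b"
    and cols: "\<And>j. j < n \<Longrightarrow> (\<Sum>i<n. B $$ (i, j)) = b"
    and V: "V \<in> carrier_mat n k" and ST: "ST_feasible V A B S T"
  shows "PB V A B \<in> QPB_values V A B S T"
    and "q \<in> QPB_values V A B S T \<Longrightarrow> PB V A B \<le> q"
proof -
  have objective: "QPB_objective V A B S T X Y
      = vectorize Y \<bullet> (Q_slack V A B S T *\<^sub>v vectorize Y) + PB V A B"
    if "doubly_stochastic n X" for X Y
    using rows cols by (rule QPB_objective_const_row_sum[OF A B _ _ that])
  have dim: "dim_row A = n" "dim_col V = k"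
    using A V by simp_all
  have psd: "psd (k * k) (Q_slack V A B S T)"
    using ST V by (simp add: ST_feasible_def)
  let ?X = "(1 / real n) \<cdot>\<^sub>m ones_mat n" and ?Y = "0\<^sub>m k k :: real mat"
  have "vectorize ?Y = 0\<^sub>v (k * k)"
  proof (rule eq_vecI)
    fix i assume "i < dim_vec (0\<^sub>v (k * k) :: real vec)"
    then have i: "i < k * k" by simp
    \<comment> \<open>k = 0 does occur, namely for n = 1; then no index i exists. The bound on
      \<open>i mod k\<close> needs k positive.\<close>
    then have "k > 0" by (cases k) auto
    with i have "i mod k < k" "i div k < k"
      by (simp_all add: less_mult_imp_div_less)
    with i show "vectorize ?Y $ i = 0\<^sub>v (k * k) $ i"
      by (simp add: vectorize_def)
  qed (simp add: vectorize_def)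
  then have "vectorize ?Y \<bullet> (Q_slack V A B S T *\<^sub>v vectorize ?Y) = 0"
    using psd by (auto simp: psd_def sym_mat_def intro!: scalar_prod_left_zero mult_mat_vec_carrier)
  then have "PB V A B = QPB_objective V A B S T ?X ?Y"
    using objective[OF doubly_stochastic_uniform[OF n]] by simp
  moreover have "?X = ?X + V * ?Y * V\<^sup>T"
  proof -
    have "V * ?Y * V\<^sup>T = 0\<^sub>m n n"
      using V by simp
    moreover have "?X \<in> carrier_mat n n"
      by (simp add: ones_mat_def)
    ultimately show ?thesis
      by simp
  qed
  ultimately show "PB V A B \<in> QPB_values V A B S T"
    using doubly_stochastic_uniform[OF n] zero_carrier_mat[of k k]
    unfolding QPB_values_def mem_Collect_eq dim
    by (intro exI[of _ ?X] exI[of _ ?Y] conjI)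
  assume "q \<in> QPB_values V A B S T"
  then obtain X Y where q: "q = QPB_objective V A B S T X Y" and X: "doubly_stochastic n X"
    and Y: "Y \<in> carrier_mat k k"
    unfolding QPB_values_def dim by blast
  have "vectorize Y \<in> carrier_vec (k * k)"
    using Y by (intro carrier_vecI) (simp add: vectorize_def)
  then have "vectorize Y \<bullet> (Q_slack V A B S T *\<^sub>v vectorize Y) \<ge> 0"
    using psd by (simp add: psd_def)
  then show "PB V A B \<le> q"
    using objective[OF X] q by simp
qed

text \<open>For fixed x, the map from y to x - y modulo N is a bijection onto the residues, and
  min(d, N - d) is unchanged when d is replaced by N - d.\<close>

lemma sum_cyclic_distance:
  fixes f :: "int \<Rightarrow> real"
  assumes "x \<in> {1..N}"
  shows "(\<Sum>y\<in>{1..N}. f (min \<bar>int x - int y\<bar> (int N - \<bar>int x - int y\<bar>)))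
    = (\<Sum>d<N. f (min (int d) (int N - int d)))"
proof (rule sum.reindex_bij_witness)
  \<comment> \<open>The case splits avoid truncated subtraction on naturals. Coordinates run from 1
    to N, so d = x must go to N rather than to 0.\<close>
  let ?i = "\<lambda>d. if d < x then x - d else N + x - d"
  let ?j = "\<lambda>y. if y \<le> x then x - y else N + x - y"
  fix y assume y: "y \<in> {1..N}"
  show "?i (?j y) = y" "?j y \<in> {..<N}"
    using assms y by auto
  show "f (min (int (?j y)) (int N - int (?j y)))
      = f (min \<bar>int x - int y\<bar> (int N - \<bar>int x - int y\<bar>))"
    using assms y by (intro arg_cong[of _ _ f]) auto
next
  let ?i = "\<lambda>d. if d < x then x - d else N + x - d"
  let ?j = "\<lambda>y. if y \<le> x then x - y else N + x - y"
  fix d assume d: "d \<in> {..<N}"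
  show "?j (?i d) = d" "?i d \<in> {1..N}"
    using assms d by auto
qed

text \<open>This is translation invariance of the torus: the right-hand side does not mention p. The
  two coordinates are recentred one after the other.\<close>

lemma sum_lee_dist:
  fixes f :: "int \<Rightarrow> real"
  assumes "p \<in> {1..n1} \<times> {1..n2}"
  shows "(\<Sum>q\<in>{1..n1} \<times> {1..n2}. f (lee_dist n1 n2 p q))
    = (\<Sum>d<n1. \<Sum>d'<n2. f (min (int d) (int n1 - int d) + min (int d') (int n2 - int d')))"
proof -
  obtain x y where p: "p = (x, y)" and x: "x \<in> {1..n1}" and y: "y \<in> {1..n2}"
    using assms by auto
  let ?c = "\<lambda>N x y. min \<bar>int x - int y\<bar> (int N - \<bar>int x - int y\<bar>)"
  have "(\<Sum>q\<in>{1..n1} \<times> {1..n2}. f (lee_dist n1 n2 p q))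
      = (\<Sum>x'\<in>{1..n1}. \<Sum>y'\<in>{1..n2}. f (?c n1 x x' + ?c n2 y y'))"
    by (simp add: sum.cartesian_product p lee_dist_def Let_def case_prod_unfold)
  also have "\<dots> = (\<Sum>x'\<in>{1..n1}. \<Sum>d'<n2. f (?c n1 x x' + min (int d') (int n2 - int d')))"
    \<comment> \<open>The placeholder becomes a schematic variable, so the rewrite rule matches
      under the outer sum, whatever the first coordinate contributes.\<close>
    using sum_cyclic_distance[OF y, of "\<lambda>t. f (_ + t)"] by simp
  also have "\<dots> = (\<Sum>d<n1. \<Sum>d'<n2. f (min (int d) (int n1 - int d) + min (int d') (int n2 - int d')))"
    using sum_cyclic_distance[OF x,
        of "\<lambda>t. \<Sum>d'<n2. f (t + min (int d') (int n2 - int d'))"] .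
  finally show ?thesis .
qed

lemma lee_dist_commute: "lee_dist n1 n2 p q = lee_dist n1 n2 q p"
  by (simp add: lee_dist_def abs_minus_commute)

lemma lee_dist_self [simp]: "lee_dist n1 n2 p p = 0"
  by (simp add: lee_dist_def)

text \<open>Since \<open>1 / 0 = 0\<close>, the zero diagonal needs no case distinction.\<close>

lemma energy_B_index:
  assumes "i < n1 * n2" and "j < n1 * n2"
  shows "energy_B n1 n2 g $$ (i, j) = 1 / real_of_int (lee_dist n1 n2 (g i) (g j))"
  using assms by (simp add: energy_B_def)

text \<open>The ordering \<open>g\<close> turns the sum over indices into one over grid points. The
  diagonal entry is the term d = d' = 0, where division by zero gives 0.\<close>

lemma energy_B_row_sum:
  assumes g: "bij_betw g {..<n1 * n2} ({1..n1} \<times> {1..n2})" and i: "i < n1 * n2"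
  shows "(\<Sum>j<n1 * n2. energy_B n1 n2 g $$ (i, j)) = (\<Sum>d<n1. \<Sum>d'<n2.
    1 / real_of_int (min (int d) (int n1 - int d) + min (int d') (int n2 - int d')))"
proof -
  have "g i \<in> {1..n1} \<times> {1..n2}"
    using bij_betwE[OF g] i by simp
  moreover have "(\<Sum>j<n1 * n2. energy_B n1 n2 g $$ (i, j))
      = (\<Sum>q\<in>{1..n1} \<times> {1..n2}. 1 / real_of_int (lee_dist n1 n2 (g i) q))"
    using i by (subst sum.reindex_bij_betw[OF g, symmetric]) (simp add: energy_B_index)
  ultimately show ?thesis
    using sum_lee_dist[of "g i" n1 n2 "\<lambda>t. 1 / real_of_int t"] by simp
qed

text \<open>\<open>B\<close> is symmetric because the Lee distance is.\<close>

lemma energy_B_col_sum: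
  assumes "j < n1 * n2"
  shows "(\<Sum>i<n1 * n2. energy_B n1 n2 g $$ (i, j)) = (\<Sum>i<n1 * n2. energy_B n1 n2 g $$ (j, i))"
  using assms by (intro sum.cong) (simp_all add: energy_B_index lee_dist_commute)

theorem proposition3p5:
  fixes n1 n2 n m :: nat and g :: "nat \<Rightarrow> nat \<times> nat" and A B V S T :: "real mat"
  assumes "n1 \<ge> 1" and "n2 \<ge> 1" and "n = n1 * n2"
    and "1 \<le> m" and "m \<le> n"
    and "bij_betw g {..<n} ({1..n1} \<times> {1..n2})"
    and "A = energy_A n m" and "B = energy_B n1 n2 g"
    and "onb_ones_perp n V"
    and "ST_optimal V A B S T"
  shows "(\<exists>q\<in>QPB_values V A B S T. \<forall>q'\<in>QPB_values V A B S T. q \<le> q') \<and>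
    PB V A B = QPB V A B S T"
proof -
  have n: "n > 0"
    using assms(1-3) by simp
  have A: "A \<in> carrier_mat n n" and B: "B \<in> carrier_mat n n"
    using assms by (simp_all add: energy_A_def energy_B_def)
  have V: "V \<in> carrier_mat n (n - 1)" and ST: "ST_feasible V A B S T"
    using assms by (simp_all add: onb_ones_perp_def ST_optimal_def)
  \<comment> \<open>The row sum formula is free of i, so it serves as the witness for b.\<close>
  obtain b where rows: "\<And>i. i < n \<Longrightarrow> (\<Sum>j<n. B $$ (i, j)) = b"
    using energy_B_row_sum[OF assms(6)[unfolded assms(3)]] unfolding assms(3,8) by blast
  have cols: "\<And>j. j < n \<Longrightarrow> (\<Sum>i<n. B $$ (i, j)) = b"
    using rows energy_B_col_sum assms(3,8) by simp
  have mem: "PB V A B \<in> QPB_values V A B S T"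
    using rows cols by (rule PB_least_QPB_value(1)[OF n A B _ _ V ST])
  have least: "PB V A B \<le> q" if "q \<in> QPB_values V A B S T" for q
    using rows cols that by (rule PB_least_QPB_value(2)[OF n A B _ _ V ST])
  from mem least have "QPB V A B S T = PB V A B"
    unfolding QPB_def by (intro Least_equality)
  with mem least show ?thesis
    by auto
qed

end
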